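(* Let $H^*=([5],[5],E)$ with $E=(\{1\}\times\{1,4,5\})\cup(\{2\}\times\{2,4,5\})\cup(\{3\}\times\{3,4,5\})\cup(\{4\}\times\{1,2,3,4\})\cup(\{5\}\times\{1,2,3,5\})$. Then $H^*$ is gapful.
   Context: A bigraph $H=([N],[M],E)$ has left part $[N]$, right part $[M]$, edges $E\subseteq[N]\times[M]$, neighborhoods $\mathcal N(\cdot)$; its base graph $G_H$ is the graph on $[N]$ where distinct $u,v$ are adjacent iff they share a neighbor. With Lebesgue measure $\mu$ on $[0,1]^M$, a family $\{A_1,\dots,A_N\}$ of measurable sets conforms with $H$ if each $A_i=B_i\times[0,1]^{[M]\setminus\mathcal N(i)}$ with $B_i\subseteq[0,1]^{\mathcal N(i)}$ measurable; $\mathcal I(H)$ is the set of $\vec p\in(0,1)^N$ such that $\mu(\bigcap_i([0,1]^M\setminus A_i))>0$ for every conforming family with $\mu(A_i)=p_i$. For a graph $G$ on $[N]$, $\mathcal I_a(G)$ is the set of $\vec p\in(0,1)^N$ such that for every probability space and events $A_1,\dots,A_N$ with $\Pr(A_i)=p_i$ for which $G$ is a dependency graph (each $A_i$ mutually independent of $\{A_j:j\ne i,j\notin\mathcal N_G(i)\}$), $\Pr(\bigcap_i\overline{A_i})>0$. $H$ is gapful if there are $\vec p\in(0,1)^N$, $\lambda>0$ with $\lambda\vec p\in\mathcal I(H)\setminus\mathcal I_a(G_H)$, and gapless otherwise. *)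

theory Defs
  imports "HOL-Probability.Probability"
begin

record bigraph =
  lsize :: nat
  rsize :: nat
  edges :: "(nat \<times> nat) set"

definition bigraph :: "bigraph \<Rightarrow> bool" where
  "bigraph H \<longleftrightarrow> edges H \<subseteq> {1..lsize H} \<times> {1..rsize H}"

definition lnbh :: "bigraph \<Rightarrow> nat \<Rightarrow> nat set" where
  "lnbh H i = {j. (i, j) \<in> edges H}"

text \<open>A simple graph on \<open>{1..n}\<close> is given by \<open>n\<close> and its set of two-element edges.\<close>

definition base_edges :: "bigraph \<Rightarrow> nat set set" where
  "base_edges H = {{u, v} | u v.
     u \<in> {1..lsize H} \<and> v \<in> {1..lsize H} \<and> u \<noteq> v \<and> lnbh H u \<inter> lnbh H v \<noteq> {}}"

definition nbh :: "nat set set \<Rightarrow> nat \<Rightarrow> nat set" where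
  "nbh F i = {j. {i, j} \<in> F}"

text \<open>Lebesgue measure on \<open>[0,1]\<^sup>J\<close>; the completion makes the measurable sets the Lebesgue
  measurable ones instead of only the Borel ones. The points are the extensional functions on \<open>J\<close>,
  so \<open>restrict x J\<close> is the projection of \<open>x\<close> to the coordinates in \<open>J\<close>.\<close>

definition cube :: "nat set \<Rightarrow> (nat \<Rightarrow> real) measure" where
  "cube J = completion (\<Pi>\<^sub>M j\<in>J. restrict_space lborel {0..1})"

definition conforms :: "bigraph \<Rightarrow> (nat \<Rightarrow> (nat \<Rightarrow> real) set) \<Rightarrow> bool" where
  "conforms H A \<longleftrightarrow>
     (\<forall>i\<in>{1..lsize H}. A i \<in> sets (cube {1..rsize H}) \<and>
        (\<exists>B \<in> sets (cube (lnbh H i)).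
           A i = {x \<in> space (cube {1..rsize H}). restrict x (lnbh H i) \<in> B}))"

text \<open>A vector in \<open>(0,1)\<^sup>n\<close> is a function of which only the values on \<open>{1..n}\<close> matter.
  In the two sets below the intersection with the whole space matters only for \<open>n = 0\<close>.\<close>

definition var_interior :: "bigraph \<Rightarrow> (nat \<Rightarrow> real) set" where
  "var_interior H = {p \<in> {1..lsize H} \<rightarrow> {0<..<1}.
     \<forall>A. conforms H A \<and> (\<forall>i\<in>{1..lsize H}. measure (cube {1..rsize H}) (A i) = p i) \<longrightarrow>
       measure (cube {1..rsize H}) (space (cube {1..rsize H}) \<inter>
         (\<Inter>i\<in>{1..lsize H}. space (cube {1..rsize H}) - A i)) > 0}"

definition dependency_graph ::
  "nat \<Rightarrow> nat set set \<Rightarrow> 'a measure \<Rightarrow> (nat \<Rightarrow> 'a set) \<Rightarrow> bool" where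
  "dependency_graph n F M A \<longleftrightarrow>
     (\<forall>i\<in>{1..n}. prob_space.indep_set M {A i}
        (sigma_sets (space M) (A ` {j \<in> {1..n}. j \<noteq> i \<and> j \<notin> nbh F i})))"

text \<open>A formula cannot quantify over the type of the sample space. The type \<^typ>\<open>nat set\<close> is
  large enough: by \<open>abs_interior_any_space\<close> below, membership implies the condition for
  probability spaces over every type.\<close>

definition abs_interior :: "nat \<Rightarrow> nat set set \<Rightarrow> (nat \<Rightarrow> real) set" where
  "abs_interior n F = {p \<in> {1..n} \<rightarrow> {0<..<1}.
     \<forall>(M :: nat set measure) A.
       prob_space M \<and> (\<forall>i\<in>{1..n}. A i \<in> sets M \<and> measure M (A i) = p i) \<and>
       dependency_graph n F M A \<longrightarrow>
       measure M (space M \<inter> (\<Inter>i\<in>{1..n}. space M - A i)) > 0}"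

definition gapful :: "bigraph \<Rightarrow> bool" where
  "gapful H \<longleftrightarrow> (\<exists>p \<in> {1..lsize H} \<rightarrow> {0<..<1}. \<exists>c > 0.
     (\<lambda>i. c * p i) \<in> var_interior H - abs_interior (lsize H) (base_edges H))"

definition H_star :: bigraph where
  "H_star = \<lparr>lsize = 5, rsize = 5,
     edges = {1} \<times> {1, 4, 5} \<union> {2} \<times> {2, 4, 5} \<union> {3} \<times> {3, 4, 5} \<union>
       {4} \<times> {1, 2, 3, 4} \<union> {5} \<times> {1, 2, 3, 5}\<rparr>"

lemma bigraph_H_star: "bigraph H_star"
  by (auto simp: bigraph_def H_star_def)

lemma abs_interior_any_space:
  fixes M :: "'a measure"
  assumes p: "p \<in> abs_interior n F" and M: "prob_space M"
    and A: "\<And>i. i \<in> {1..n} \<Longrightarrow> A i \<in> sets M"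
    and pr: "\<And>i. i \<in> {1..n} \<Longrightarrow> measure M (A i) = p i"
    and dep: "dependency_graph n F M A"
  shows "measure M (space M \<inter> (\<Inter>i\<in>{1..n}. space M - A i)) > 0"
proof -
  interpret prob_space M by (rule M)
  define f where "f x = {i \<in> {1..n}. x \<in> A i}" for x
  define D where "D = distr M (count_space UNIV) f"
  define C where "C i = {S :: nat set. i \<in> S}" for i
  have f: "f \<in> measurable M (count_space UNIV)"
  proof -
    have "f -` {S} \<inter> space M \<in> sets M" if S: "S \<in> Pow {1..n}" for S
    proof -
      have "{x \<in> space M. (x \<in> A i) = (i \<in> S)} \<in> sets M" if "i \<in> {1..n}" for i
      proof -
        have "{x \<in> space M. (x \<in> A i) = (i \<in> S)} = (if i \<in> S then A i else space M - A i)"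
          using sets.sets_into_space[OF A[OF that]] by auto
        then show ?thesis using A[OF that] by simp
      qed
      then have "{x \<in> space M. \<forall>i\<in>{1..n}. (x \<in> A i) = (i \<in> S)} \<in> sets M"
        by (intro sets.sets_Collect_finite_All) auto
      moreover have "f -` {S} \<inter> space M = {x \<in> space M. \<forall>i\<in>{1..n}. (x \<in> A i) = (i \<in> S)}"
        using S unfolding f_def by blast
      ultimately show ?thesis by simp
    qed
    then have "f \<in> measurable M (count_space (Pow {1..n}))"
      by (subst measurable_count_space_eq2) (auto simp: f_def)
    from measurable_compose[OF this, of "\<lambda>x. x" "count_space UNIV"] show ?thesis by simp
  qed
  have sD: "space D = UNIV" "sets D = UNIV"
    by (simp_all add: D_def)
  have mD: "measure D X = measure M (f -` X \<inter> space M)" for X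
    unfolding D_def using f by (simp add: measure_distr)
  have D: "prob_space D" unfolding D_def by (rule prob_space_distr[OF f])
  have preC: "f -` C i \<inter> space M = A i" if "i \<in> {1..n}" for i
    using that sets.sets_into_space[OF A[OF that]] by (auto simp: f_def C_def)
  have depD: "dependency_graph n F D C"
    unfolding dependency_graph_def
  proof
    fix i assume i: "i \<in> {1..n}"
    let ?J = "{j \<in> {1..n}. j \<noteq> i \<and> j \<notin> nbh F i}"
    have ind: "indep_set {A i} (sigma_sets (space M) (A ` ?J))"
      using dep i unfolding dependency_graph_def by blast
    have pre: "f -` X \<inter> space M \<in> sigma_sets (space M) (A ` ?J)"
      if "X \<in> sigma_sets UNIV (C ` ?J)" for X
      using that
    proof induction
      case (Basic a)
      then obtain j where "j \<in> ?J" "a = C j" by blast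
      then show ?case using preC[of j] by auto
    next
      case Empty
      show ?case by (simp add: sigma_sets.Empty)
    next
      case (Compl a)
      have "f -` (UNIV - a) \<inter> space M = space M - (f -` a \<inter> space M)" by auto
      then show ?case using Compl by (simp add: sigma_sets.Compl)
    next
      case (Union a)
      have "f -` (\<Union>i. a i) \<inter> space M = (\<Union>i. f -` a i \<inter> space M)" by auto
      then show ?case using Union.IH by (simp only: sigma_sets.Union)
    qed
    show "prob_space.indep_set D {C i} (sigma_sets (space D) (C ` ?J))"
      unfolding prob_space.indep_sets2_eq[OF D] sD
    proof (intro conjI ballI)
      fix a X assume a: "a \<in> {C i}" and X: "X \<in> sigma_sets UNIV (C ` ?J)"
      have "f -` (C i \<inter> X) \<inter> space M = A i \<inter> (f -` X \<inter> space M)"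
        using preC[OF i] by auto
      then show "measure D (a \<inter> X) = measure D a * measure D X"
        using ind pre[OF X] a preC[OF i] unfolding indep_sets2_eq by (simp add: mD)
    qed auto
  qed
  have pos: "measure D (space D \<inter> (\<Inter>i\<in>{1..n}. space D - C i)) > 0"
  proof -
    have *: "\<And>(M :: nat set measure) A. prob_space M \<Longrightarrow>
        (\<And>i. i \<in> {1..n} \<Longrightarrow> A i \<in> sets M \<and> measure M (A i) = p i) \<Longrightarrow>
        dependency_graph n F M A \<Longrightarrow>
        measure M (space M \<inter> (\<Inter>i\<in>{1..n}. space M - A i)) > 0"
      using p unfolding abs_interior_def by blast
    show ?thesis
      by (rule *[OF D _ depD]) (simp_all only: sD mD preC pr UNIV_I simp_thms)
  qed
  have "measure D (space D \<inter> (\<Inter>i\<in>{1..n}. space D - C i)) =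
      measure M (space M \<inter> (\<Inter>i\<in>{1..n}. space M - A i))"
    unfolding mD sD by (rule arg_cong[where f = "measure M"]) (auto simp: f_def C_def)
  with pos show ?thesis by argo
qed

end

theory Submission
  imports Defs
begin

text \<open>The base graph of \<open>H\<^sup>*\<close> is complete, so five disjoint events of probability \<open>1/5\<close> show that
  \<open>(1/5, \<dots>, 1/5)\<close> is not in \<open>\<I>\<^sub>a\<close>. It remains to see that it is in \<open>\<I>(H\<^sup>*)\<close>: otherwise the cube is
  partitioned, up to null sets, into \<open>A\<^sub>1, \<dots>, A\<^sub>5\<close> of measure \<open>1/5\<close>. For fixed \<open>(x\<^sub>1, x\<^sub>2, x\<^sub>3)\<close> the sections
  of \<open>A\<^sub>4\<close> and \<open>A\<^sub>5\<close> are a vertical and a horizontal strip in the \<open>(x\<^sub>4, x\<^sub>5)\<close>-square, and they are disjoint,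
  so one of them is empty. Hence the part of the square left over by \<open>A\<^sub>1, A\<^sub>2, A\<^sub>3\<close> is always a strip.

  Three cases arise. If two of \<open>A\<^sub>1, A\<^sub>2, A\<^sub>3\<close> do not depend on their private variable, they
  occupy measure \<open>2/5\<close> inside a rectangle \<open>a \<times> b\<close> of the square which \<open>A\<^sub>4\<close> and \<open>A\<^sub>5\<close> must avoid, and this
  forces \<open>a + b \<le> 6/5\<close> and \<open>a b \<le> 9/25\<close>. If \<open>A\<^sub>5\<close> does not depend on \<open>x\<^sub>5\<close>, it is contained in a box
  \<open>F\<^sub>1 \<times> F\<^sub>2 \<times> F\<^sub>3\<close> with \<open>1/5 \<le> (1 - |F\<^sub>i|) q\<^sub>i\<close>, where \<open>q\<^sub>1 + q\<^sub>2 + q\<^sub>3 \<le> 1\<close>, and its measure is at most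
  \<open>2/5 \<cdot> 3/5 \<cdot> 4/5 < 1/5\<close>; likewise for \<open>A\<^sub>4\<close>. Otherwise a finite random sample of coordinates yields,
  with positive probability, an exact partition of a finite grid in which all the dependences are
  visible, and this is combinatorially impossible: changing one coordinate cannot turn a proper vertical
  strip into a proper horizontal one.\<close>

section \<open>Partitions with strips\<close>

text \<open>Suppose \<open>U a b c\<close> were horizontal with profile \<open>W\<close> and
  \<open>U a' b c\<close> vertical with profile \<open>V\<close>, both nonconstant. Take
  \<open>b'\<close> that changes \<open>g\<close> at \<open>(y1, z1)\<close>. Wherever
  \<open>V y \<noteq> W z\<close>, one of \<open>f a\<close>, \<open>f a'\<close> holds and excludes
  \<open>g\<close>, so \<open>U a b' c\<close> still has the value \<open>W z\<close>; at
  \<open>(y1, z1)\<close> it has not. Then \<open>U a b' c\<close> depends on both \<open>y\<close>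
  and \<open>z\<close> and is no strip.\<close>

lemma strip_switch:
  fixes f :: "'a \<Rightarrow> 'y \<Rightarrow> 'z \<Rightarrow> bool" and g :: "'b \<Rightarrow> 'y \<Rightarrow> 'z \<Rightarrow> bool"
    and h :: "'c \<Rightarrow> 'y \<Rightarrow> 'z \<Rightarrow> bool"
  defines "U \<equiv> \<lambda>a b c y z. \<not> f a y z \<and> \<not> g b y z \<and> \<not> h c y z"
  assumes fg: "\<And>a b y z. \<not> (f a y z \<and> g b y z)"
    and fh: "\<And>a c y z. \<not> (f a y z \<and> h c y z)"
    and gh: "\<And>b c y z. \<not> (g b y z \<and> h c y z)"
    and strip: "\<And>a b c. (\<forall>y z z'. U a b c y z = U a b c y z') \<or> (\<forall>y y' z. U a b c y z = U a b c y' z)"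
    and g: "g b0 y1 z1 \<noteq> g b1 y1 z1" and h: "h c0 y2 z2"
  shows "(\<forall>y z z'. U a b c y z = U a b c y z') \<or> (\<forall>y y' z. U a' b c y z = U a' b c y' z)"
proof (rule ccontr)
  assume "\<not> ?thesis"
  then have nV: "\<not> (\<forall>y z z'. U a b c y z = U a b c y z')"
    and nW: "\<not> (\<forall>y y' z. U a' b c y z = U a' b c y' z)" by blast+
  define V where "V y = U a' b c y z1" for y
  define W where "W z = U a b c y1 z" for z
  have V: "U a' b c y z = V y" for y z
    using strip[of a' b c] nW unfolding V_def by blast
  have W: "U a b c y z = W z" for y z
    using strip[of a b c] nV unfolding W_def by blast
  obtain ya yb where y: "V ya \<noteq> V yb" using nW unfolding V by blast
  obtain za zb where z: "W za \<noteq> W zb" using nV unfolding W by blast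
  obtain b' where b': "g b' y1 z1 \<noteq> g b y1 z1" using g by metis
  \<comment> \<open>One of \<open>g b\<close>, \<open>g b'\<close> holds at \<open>(y1, z1)\<close>,
    which excludes every \<open>f\<close>, so \<open>a\<close> and \<open>a'\<close> give the same
    value there.\<close>
  have VW1: "V y1 = W z1"
    using V[of y1 z1] W[of y1 z1] b' fg gh unfolding U_def by metis
  have VW2: "V y2 = W z2"
    using V[of y2 z2] W[of y2 z2] h fh gh unfolding U_def by metis
  have off: "U a b' c y z = W z" if "V y \<noteq> W z" for y z
    using V[of y z] W[of y z] that fg unfolding U_def by metis
  have at2: "U a b' c y2 z2 = W z2"
    using W[of y2 z2] h fh gh unfolding U_def by metis
  have at1: "U a b' c y1 z1 \<noteq> W z1"
    using W[of y1 z1] b' fg gh unfolding U_def by metis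
  obtain z3 where z3: "W z3 \<noteq> V y2" using z by metis
  have "U a b' c y2 z3 \<noteq> U a b' c y2 z2" using off[of y2 z3] at2 z3 VW2 by metis
  then have "U a b' c y z = U a b' c y' z" for y y' z using strip[of a b' c] by blast
  moreover obtain y4 where "V y4 \<noteq> W z1" using y by metis
  ultimately show False using off[of y4 z1] at1 by metis
qed

text \<open>By disjointness, the leftovers formed with \<open>r\<close> differ exactly as
  \<open>f a\<close> and \<open>f a'\<close> do, so this difference is independent of
  \<open>z\<close>; those formed with \<open>s\<close> make it independent of \<open>y\<close>. It
  is zero at a point of \<open>h\<close>, hence everywhere.\<close>

lemma difference_of_strips_constant:
  fixes f :: "'a \<Rightarrow> 'y \<Rightarrow> 'z \<Rightarrow> bool" and r s :: "'y \<Rightarrow> 'z \<Rightarrow> bool"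
  assumes h: "h y2 z2"
    and fh: "\<And>a y z. \<not> (f a y z \<and> h y z)" 
    and fr: "\<And>a y z. \<not> (f a y z \<and> r y z)" 
    and fs: "\<And>a y z. \<not> (f a y z \<and> s y z)" 
    and V: "\<And>y z z'. (\<not> f a y z \<and> \<not> r y z) = (\<not> f a y z' \<and> \<not> r y z')"
      "\<And>y z z'. (\<not> f a' y z \<and> \<not> r y z) = (\<not> f a' y z' \<and> \<not> r y z')"
    and W: "\<And>y y' z. (\<not> f a y z \<and> \<not> s y z) = (\<not> f a y' z \<and> \<not> s y' z)"
      "\<And>y y' z. (\<not> f a' y z \<and> \<not> s y z) = (\<not> f a' y' z \<and> \<not> s y' z)"
  shows "f a y z = f a' y z"
proof (rule ccontr)
  assume "f a y z \<noteq> f a' y z"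
  then have "f a y z2 \<noteq> f a' y z2" using V fr by metis
  then have "f a y2 z2 \<noteq> f a' y2 z2" using W fs by metis
  then show False using h fh by metis
qed

text \<open>Changing one coordinate of a proper vertical strip leaves it vertical, and changing one of a
  proper horizontal strip leaves it horizontal. So the difference made by each change from
  \<open>(a, b, c)\<close> to \<open>(a', b', c')\<close> depends neither on \<open>z\<close> nor on \<open>y\<close>, and it vanishes where another of the
  three functions is true, hence everywhere.\<close>

lemma no_mixed_strip_partition:
  fixes f :: "'a \<Rightarrow> 'y \<Rightarrow> 'z \<Rightarrow> bool" and g :: "'b \<Rightarrow> 'y \<Rightarrow> 'z \<Rightarrow> bool"
    and h :: "'c \<Rightarrow> 'y \<Rightarrow> 'z \<Rightarrow> bool"
    and p :: "'a \<Rightarrow> 'b \<Rightarrow> 'c \<Rightarrow> 'y \<Rightarrow> bool" and q :: "'a \<Rightarrow> 'b \<Rightarrow> 'c \<Rightarrow> 'z \<Rightarrow> bool"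
  assumes fg: "\<And>a b y z. \<not> (f a y z \<and> g b y z)"
    and fh: "\<And>a c y z. \<not> (f a y z \<and> h c y z)"
    and gh: "\<And>b c y z. \<not> (g b y z \<and> h c y z)"
    and pq: "\<And>a b c y z. \<not> (p a b c y \<and> q a b c z)"
    and U: "\<And>a b c y z. (p a b c y \<or> q a b c z) = (\<not> f a y z \<and> \<not> g b y z \<and> \<not> h c y z)"
    and f: "f a0 y0 z0 \<noteq> f a1 y0 z0" and g: "g b0 y1 z1 \<noteq> g b1 y1 z1" and h: "h c0 y2 z2"
    and p: "p a b c y3" "\<not> p a b c y4" and q: "q a' b' c' z3" "\<not> q a' b' c' z4"
  shows False
proof -
  define V where "V a b c \<longleftrightarrow> (\<forall>y z z'. (\<not> f a y z \<and> \<not> g b y z \<and> \<not> h c y z) = (\<not> f a y z' \<and> \<not> g b y z' \<and> \<not> h c y z'))" for a b c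
  define W where "W a b c \<longleftrightarrow> (\<forall>y y' z. (\<not> f a y z \<and> \<not> g b y z \<and> \<not> h c y z) = (\<not> f a y' z \<and> \<not> g b y' z \<and> \<not> h c y' z))" for a b c
  have VW: "V a b c \<or> W a b c" for a b c
  proof -
    have "(\<forall>y. \<not> p a b c y) \<or> (\<forall>z. \<not> q a b c z)" using pq by metis
    then show ?thesis unfolding V_def W_def U[symmetric] by metis
  qed
  have switch_f: "V a b c \<or> W a' b c" for a a' b c
    using strip_switch[of f g h b0 y1 z1 b1 c0 y2 z2 a b c a'] fg fh gh g h VW unfolding V_def W_def
    by blast
  have switch_g: "V a b c \<or> W a b' c" for a b b' c
    using strip_switch[of g f h a0 y0 z0 a1 c0 y2 z2 b a c b'] fg fh gh f h VW unfolding V_def W_def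
    by (simp only: conj_ac de_Morgan_conj) blast
  have switch_h: "V a b c \<or> W a b c'" for a b c c'
  proof -
    \<comment> \<open>Here \<open>g\<close> takes the third role in \<open>strip_switch\<close>,
      which asks for a point where it is true.\<close>
    obtain b2 y z where "g b2 y z" using g by metis
    then show ?thesis
    using strip_switch[of h f g a0 y0 z0 a1 b2 y z c a b c'] fg fh gh f VW unfolding V_def W_def
    by (simp only: conj_ac de_Morgan_conj) blast
  qed
  have nq: "\<not> q a b c z" for z using p pq by metis
  have np: "\<not> p a' b' c' y" for y using q pq by metis
  have nW: "\<not> W a b c" unfolding W_def U[symmetric] using p nq by metis
  have nV: "\<not> V a' b' c'" unfolding V_def U[symmetric] using q np by metis
  have V0: "V a b c" and W0: "W a' b' c'" using VW nV nW by blast+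
  have V1: "V a' b c" "V a b' c" "V a b c'" using switch_f switch_g switch_h nW by blast+
  have W1: "W a b' c'" "W a' b c'" "W a' b' c" using switch_f switch_g switch_h nV by blast+
  have eq_f: "f a y z = f a' y z" for y z
    using difference_of_strips_constant[of "h c0" y2 z2 f "\<lambda>y z. g b y z \<or> h c y z" "\<lambda>y z. g b' y z \<or> h c' y z" a a' y z]
      h fg fh V0 V1 W0 W1 unfolding V_def W_def by (simp only: de_Morgan_disj) blast
  have eq_g: "g b y z = g b' y z" for y z
    using difference_of_strips_constant[of "h c0" y2 z2 g "\<lambda>y z. f a y z \<or> h c y z" "\<lambda>y z. f a' y z \<or> h c' y z" b b' y z]
      h fg gh V0 V1 W0 W1 unfolding V_def W_def by (simp only: de_Morgan_disj conj_ac) blast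
  have eq_h: "h c y z = h c' y z" for y z
  proof -
    obtain b2 y' z' where "g b2 y' z'" using g by metis
    then show ?thesis
      using difference_of_strips_constant[of "g b2" y' z' h "\<lambda>y z. f a y z \<or> g b y z" "\<lambda>y z. f a' y z \<or> g b' y z" c c' y z]
        fh gh V0 V1 W0 W1 unfolding V_def W_def by (simp only: de_Morgan_disj conj_ac) blast
  qed
  show False using V0 nV eq_f eq_g eq_h unfolding V_def by simp
qed

section \<open>Essential projections in finite products\<close>

locale iid_product =
  fixes U :: "'a measure" and I :: "'i set"
  assumes prob_space_U: "prob_space U" and finite_I: "finite I"
begin

abbreviation P :: "('i \<Rightarrow> 'a) measure" where "P \<equiv> \<Pi>\<^sub>M i\<in>I. U"

sublocale P: prob_space P
  by (intro prob_space_PiM prob_space_U)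

sublocale PP: pair_prob_space P P ..

text \<open>With \<open>x\<close> fixed and \<open>y\<close> random, this point follows the law of
  \<open>P\<close> conditioned on the coordinates in \<open>J\<close>.\<close>

definition mix :: "'i set \<Rightarrow> ('i \<Rightarrow> 'a) \<Rightarrow> ('i \<Rightarrow> 'a) \<Rightarrow> 'i \<Rightarrow> 'a" where
  "mix J x y = (\<lambda>i\<in>I. if i \<in> J then x i else y i)"

definition depends_on :: "('i \<Rightarrow> 'a) set \<Rightarrow> 'i set \<Rightarrow> bool" where
  "depends_on A J \<longleftrightarrow>
     (\<forall>x\<in>space P. \<forall>y\<in>space P. (\<forall>i\<in>I \<inter> J. x i = y i) \<longrightarrow> x \<in> A \<longrightarrow> y \<in> A)"

text \<open>Up to null sets, the smallest event containing \<open>A\<close> that depends only on the coordinates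
  in \<open>J\<close>.\<close>

definition ess :: "'i set \<Rightarrow> ('i \<Rightarrow> 'a) set \<Rightarrow> ('i \<Rightarrow> 'a) set" where
  "ess J A = {x \<in> space P. 0 < measure P {y \<in> space P. mix J x y \<in> A}}"

text \<open>The converse inclusion is \<open>AE_in_ess\<close>, so \<open>A\<close> agrees up to a
  null set with an event on the coordinates in \<open>J\<close>.\<close>

definition determined :: "'i set \<Rightarrow> ('i \<Rightarrow> 'a) set \<Rightarrow> bool" where
  "determined J A \<longleftrightarrow> (AE x in P. x \<in> ess J A \<longrightarrow> x \<in> A)"

lemma depends_onD:
  assumes "depends_on A J" "x \<in> space P" "y \<in> space P" "\<And>i. i \<in> I \<Longrightarrow> i \<in> J \<Longrightarrow> x i = y i"
  shows "x \<in> A \<longleftrightarrow> y \<in> A"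
  using assms unfolding depends_on_def by (metis IntE)

lemma depends_on_Int: "depends_on A J \<Longrightarrow> depends_on B K \<Longrightarrow> depends_on (A \<inter> B) (J \<union> K)"
  unfolding depends_on_def by blast

section \<open>Resampling coordinates\<close>

lemma mix_apply [simp]: "i \<in> I \<Longrightarrow> mix J x y i = (if i \<in> J then x i else y i)"
  by (simp add: mix_def)

lemma mix_in_space [simp]: "x \<in> space P \<Longrightarrow> y \<in> space P \<Longrightarrow> mix J x y \<in> space P"
  by (auto simp: mix_def space_PiM)

lemma measurable_mix [measurable]: "(\<lambda>(x, y). mix J x y) \<in> measurable (P \<Otimes>\<^sub>M P) P"
  unfolding mix_def split_beta by measurable

lemma measurable_mix2 [measurable]: "x \<in> space P \<Longrightarrow> mix J x \<in> measurable P P"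
  using measurable_Pair2[OF measurable_mix, of x J] by simp

text \<open>For a box the condition splits into one on \<open>x\<close> in the coordinates of
  \<open>J\<close> and one on \<open>y\<close> in the others. Boxes determine the product
  measure.\<close>

lemma distr_mix: "distr (P \<Otimes>\<^sub>M P) P (\<lambda>(x, y). mix J x y) = P"
proof -
  interpret U: prob_space U by (rule prob_space_U)
  interpret product_sigma_finite "\<lambda>_ :: 'i. U" ..
  show ?thesis
  proof (rule PiM_eqI[OF finite_I])
    fix A :: "'i \<Rightarrow> 'a set" assume A: "\<And>i. i \<in> I \<Longrightarrow> A i \<in> sets U"
    define B where "B = (\<lambda>i. if i \<in> J then A i else space U)"
    define C where "C = (\<lambda>i. if i \<in> J then space U else A i)"
    have B: "Pi\<^sub>E I B \<in> sets P" and C: "Pi\<^sub>E I C \<in> sets P" and A': "Pi\<^sub>E I A \<in> sets P"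
      using A by (auto simp: B_def C_def intro!: sets_PiM_I_finite finite_I)
    have "A i \<subseteq> space U" if "i \<in> I" for i using A[OF that] sets.sets_into_space by blast
    then have "(\<lambda>(x, y). mix J x y) -` Pi\<^sub>E I A \<inter> space (P \<Otimes>\<^sub>M P) = Pi\<^sub>E I B \<times> Pi\<^sub>E I C"
      by (auto simp: space_pair_measure space_PiM mix_def B_def C_def PiE_iff extensional_def
          split: if_splits) (metis subsetD)+
    then have "emeasure (distr (P \<Otimes>\<^sub>M P) P (\<lambda>(x, y). mix J x y)) (Pi\<^sub>E I A) =
        emeasure P (Pi\<^sub>E I B) * emeasure P (Pi\<^sub>E I C)"
      using A' B C by (simp add: emeasure_distr P.emeasure_pair_measure_Times)
    also have "\<dots> = (\<Prod>i\<in>I. emeasure U (B i)) * (\<Prod>i\<in>I. emeasure U (C i))"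
      using A by (subst (1 2) emeasure_PiM[OF finite_I]) (auto simp: B_def C_def)
    also have "\<dots> = (\<Prod>i\<in>I. emeasure U (A i))"
      unfolding prod.distrib[symmetric]
      by (intro prod.cong) (auto simp: B_def C_def U.emeasure_space_1)
    finally show "emeasure (distr (P \<Otimes>\<^sub>M P) P (\<lambda>(x, y). mix J x y)) (Pi\<^sub>E I A) =
      (\<Prod>i\<in>I. emeasure U (A i))" .
  qed simp
qed

lemma AE_mix:
  assumes "AE x in P. Q x"
  shows "AE x in P. AE y in P. Q (mix J x y)"
proof -
  have "AE x in distr (P \<Otimes>\<^sub>M P) P (\<lambda>(x, y). mix J x y). Q x"
    using assms by (simp only: distr_mix)
  then have "AE z in P \<Otimes>\<^sub>M P. Q (case z of (x, y) \<Rightarrow> mix J x y)"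
    by (rule AE_distrD[OF measurable_mix])
  from PP.AE_pair[OF this] show ?thesis by simp
qed

lemma AE_mixD:
  assumes "{x \<in> space P. Q x} \<in> sets P" "AE x in P. AE y in P. Q (mix J x y)"
  shows "AE x in P. Q x"
proof -
  have "{z \<in> space (P \<Otimes>\<^sub>M P). Q (case z of (x, y) \<Rightarrow> mix J x y)} =
      (\<lambda>(x, y). mix J x y) -` {x \<in> space P. Q x} \<inter> space (P \<Otimes>\<^sub>M P)"
    by (auto simp: space_pair_measure)
  also have "\<dots> \<in> sets (P \<Otimes>\<^sub>M P)" using assms(1) by measurable
  finally have "AE z in P \<Otimes>\<^sub>M P. Q (case z of (x, y) \<Rightarrow> mix J x y)"
    using assms(2) by (intro PP.AE_pair_measure) auto
  then show ?thesis
    using assms(1) by (subst distr_mix[of J, symmetric]) (simp add: AE_distr_iff[OF measurable_mix])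
qed

text \<open>Whether \<open>mix J x y\<close> is in \<open>A\<close> is decided by \<open>x\<close>,
  and whether it is in \<open>B\<close> by \<open>y\<close>: the preimage of
  \<open>A \<inter> B\<close> is \<open>A \<times> B\<close>.\<close>

lemma prob_Int_independent:
  assumes A: "A \<in> sets P" "depends_on A J" and B: "B \<in> sets P" "depends_on B K" and "J \<inter> K = {}"
  shows "measure P (A \<inter> B) = measure P A * measure P B"
proof -
  have memA: "mix J x y \<in> A \<longleftrightarrow> x \<in> A" if "x \<in> space P" "y \<in> space P" for x y
    using that by (intro depends_onD[OF A(2)]) auto
  have memB: "mix J x y \<in> B \<longleftrightarrow> y \<in> B" if "x \<in> space P" "y \<in> space P" for x y
    using that \<open>J \<inter> K = {}\<close> by (intro depends_onD[OF B(2)]) auto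
  have sub: "A \<subseteq> space P" "B \<subseteq> space P" using A B sets.sets_into_space by blast+
  have "(\<lambda>(x, y). mix J x y) -` (A \<inter> B) \<inter> space (P \<Otimes>\<^sub>M P) = A \<times> B"
  proof (rule set_eqI, clarify)
    fix x y
    show "(x, y) \<in> (\<lambda>(x, y). mix J x y) -` (A \<inter> B) \<inter> space (P \<Otimes>\<^sub>M P) \<longleftrightarrow> (x, y) \<in> A \<times> B"
    proof (cases "x \<in> space P \<and> y \<in> space P")
      case True
      then show ?thesis using memA[of x y] memB[of x y] by (simp add: space_pair_measure)
    next
      case False
      then show ?thesis using sub by (auto simp: space_pair_measure)
    qed
  qed
  moreover have "emeasure P (A \<inter> B) = emeasure (distr (P \<Otimes>\<^sub>M P) P (\<lambda>(x, y). mix J x y)) (A \<inter> B)"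
    by (simp only: distr_mix)
  ultimately have "emeasure P (A \<inter> B) = emeasure (P \<Otimes>\<^sub>M P) (A \<times> B)"
    using A B by (simp add: emeasure_distr)
  also have "\<dots> = emeasure P A * emeasure P B"
    using A B by (simp add: P.emeasure_pair_measure_Times)
  finally show ?thesis by (simp add: measure_def enn2real_mult)
qed

lemma sets_ess [measurable]:
  assumes [measurable]: "A \<in> sets P"
  shows "ess J A \<in> sets P"
proof -
  have "(\<lambda>x. measure P {y \<in> space P. mix J x y \<in> A}) \<in> borel_measurable P"
    by measurable
  then show ?thesis unfolding ess_def by measurable
qed

lemma depends_on_ess: "depends_on (ess J A) J"
proof -
  have "y \<in> ess J A" if "y \<in> space P" "\<forall>i\<in>I \<inter> J. x i = y i" "x \<in> ess J A" for x y
  proof -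
    have "mix J x = mix J y" using that(2) by (auto simp: mix_def fun_eq_iff)
    then show ?thesis using that by (simp add: ess_def)
  qed
  then show ?thesis unfolding depends_on_def by blast
qed

lemma AE_not_in_iff_measure:
  assumes "A \<in> sets P"
  shows "(AE x in P. x \<notin> A) \<longleftrightarrow> measure P A = 0"
  using assms P.emeasure_eq_measure[of A] AE_iff_null_sets[OF assms]
  by (auto simp: null_sets_def)

lemma section_in_sets: "A \<in> sets P \<Longrightarrow> x \<in> space P \<Longrightarrow> {y \<in> space P. mix J x y \<in> A} \<in> sets P"
  using measurable_sets[OF measurable_mix2, of x A J] by (simp add: vimage_def Int_def conj_commute)

lemma not_in_ess_iff:
  assumes "A \<in> sets P" "x \<in> space P"
  shows "x \<notin> ess J A \<longleftrightarrow> (AE y in P. mix J x y \<notin> A)"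
proof -
  have "(AE y in P. mix J x y \<notin> A) \<longleftrightarrow> (AE y in P. y \<notin> {y \<in> space P. mix J x y \<in> A})"
    by (rule AE_cong) simp
  then show ?thesis
    using AE_not_in_iff_measure[OF section_in_sets[OF assms]] assms
    by (auto simp: ess_def zero_less_measure_iff)
qed

text \<open>Resampling outside \<open>J\<close> does not change membership in
  \<open>ess J A\<close>, and for \<open>x\<close> outside \<open>ess J A\<close> the resampled
  point almost surely misses \<open>A\<close>.\<close>

lemma AE_in_ess:
  assumes A: "A \<in> sets P"
  shows "AE x in P. x \<in> A \<longrightarrow> x \<in> ess J A"
proof (rule AE_mixD)
  show "{x \<in> space P. x \<in> A \<longrightarrow> x \<in> ess J A} \<in> sets P" using A by measurable
  have "AE y in P. mix J x y \<in> A \<longrightarrow> mix J x y \<in> ess J A" if x: "x \<in> space P" for x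
  proof -
    have *: "mix J x y \<in> ess J A \<longleftrightarrow> x \<in> ess J A" if "y \<in> space P" for y
      using x that by (intro depends_onD[OF depends_on_ess]) auto
    show ?thesis
    proof (cases "x \<in> ess J A")
      case True
      then show ?thesis using * by (auto intro!: AE_I2)
    next
      case False
      then show ?thesis using not_in_ess_iff[OF A x, of J] by (auto elim: eventually_mono)
    qed
  qed
  then show "AE x in P. AE y in P. mix J x y \<in> A \<longrightarrow> mix J x y \<in> ess J A"
    by (rule AE_I2)
qed

text \<open>Conditionally on the coordinates in \<open>J\<close>, two events sharing no further coordinate are
  independent, so one of them is conditionally null.\<close>

lemma AE_ess_disjoint:
  assumes A: "A \<in> sets P" "depends_on A S" and B: "B \<in> sets P" "depends_on B T"
    and J: "S \<inter> T \<subseteq> J" and disj: "AE x in P. \<not> (x \<in> A \<and> x \<in> B)"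
  shows "AE x in P. \<not> (x \<in> ess J A \<and> x \<in> ess J B)"
  using AE_mix[OF disj, of J] AE_space
proof eventually_elim
  case (elim x)
  have section_depends: "depends_on {y \<in> space P. mix J x y \<in> D} (R - J)" if "depends_on D R" for D R
    unfolding depends_on_def
  proof safe
    fix y z assume "y \<in> space P" "z \<in> space P" "\<forall>i\<in>I \<inter> (R - J). y i = z i" "mix J x y \<in> D"
    then show "mix J x z \<in> D"
      using elim depends_onD[OF that, of "mix J x y" "mix J x z"] by auto
  qed
  let ?A = "{y \<in> space P. mix J x y \<in> A}" and ?B = "{y \<in> space P. mix J x y \<in> B}"
  have sets: "?A \<in> sets P" "?B \<in> sets P" using A B elim by (auto intro: section_in_sets)
  have "measure P ?A * measure P ?B = measure P (?A \<inter> ?B)"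
    using J by (intro prob_Int_independent[symmetric, where J = "S - J" and K = "T - J"] sets section_depends A B) auto
  also have "\<dots> = 0"
    using sets elim by (subst AE_not_in_iff_measure[symmetric]) auto
  finally show ?case by (auto simp: ess_def)
qed

text \<open>\<open>A\<close> is essentially contained in the intersection of its two projections,
  which are independent.\<close>

lemma prob_le_ess_mult:
  assumes A: "A \<in> sets P" and "J \<inter> K = {}"
  shows "measure P A \<le> measure P (ess J A) * measure P (ess K A)"
proof -
  have "measure P A \<le> measure P (ess J A \<inter> ess K A)"
    using AE_in_ess[OF A, of J] AE_in_ess[OF A, of K] A
    by (intro P.finite_measure_mono_AE) auto
  also have "\<dots> = measure P (ess J A) * measure P (ess K A)"
    using assms by (intro prob_Int_independent[where J = J and K = K] depends_on_ess sets_ess)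
  finally show ?thesis .
qed

lemma prob_le_ess_mult3:
  assumes A: "A \<in> sets P" and "J \<inter> K = {}" "J \<inter> L = {}" "K \<inter> L = {}"
  shows "measure P A \<le> measure P (ess J A) * measure P (ess K A) * measure P (ess L A)"
proof -
  have "measure P A \<le> measure P (ess J A \<inter> (ess K A \<inter> ess L A))"
    using AE_in_ess[OF A, of J] AE_in_ess[OF A, of K] AE_in_ess[OF A, of L] A
    by (intro P.finite_measure_mono_AE) auto
  also have "\<dots> = measure P (ess J A) * measure P (ess K A \<inter> ess L A)"
    using assms
    by (intro prob_Int_independent[where J = J and K = "K \<union> L"] depends_on_ess depends_on_Int sets_ess sets.Int) auto
  also have "measure P (ess K A \<inter> ess L A) = measure P (ess K A) * measure P (ess L A)"
    using assms by (intro prob_Int_independent[where J = K and K = L] depends_on_ess sets_ess)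
  finally show ?thesis by (simp add: mult.assoc)
qed

lemma prob_Un_AE_disjoint:
  assumes "A \<in> sets P" "B \<in> sets P" "AE x in P. \<not> (x \<in> A \<and> x \<in> B)"
  shows "measure P (A \<union> B) = measure P A + measure P B"
proof -
  have "measure P (A \<union> B) = measure P A + measure P (B - A)"
    using assms P.finite_measure_Union[of A "B - A"] by simp
  also have "measure P (B - A) = measure P B"
    using assms by (intro P.finite_measure_eq_AE) auto
  finally show ?thesis .
qed

lemma prob_add_le_1:
  assumes "A \<in> sets P" "B \<in> sets P" "AE x in P. \<not> (x \<in> A \<and> x \<in> B)"
  shows "measure P A + measure P B \<le> 1"
  by (metis P.prob_le_1 prob_Un_AE_disjoint[OF assms])

subsection \<open>Sampling\<close>

text \<open>Points of the product over \<open>I \<times> UNIV\<close> serve as independent samples of points of the product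
  over \<open>I\<close>, one for each element of \<open>'k\<close>; \<open>pick n\<close> takes the coordinate \<open>t\<close> from sample \<open>n t\<close>.\<close>

definition pick :: "('i \<Rightarrow> 'k) \<Rightarrow> ('i \<times> 'k \<Rightarrow> 'a) \<Rightarrow> 'i \<Rightarrow> 'a" where
  "pick n \<omega> = (\<lambda>t\<in>I. \<omega> (t, n t))"

abbreviation Samples :: "('i \<times> 'k::finite \<Rightarrow> 'a) measure" where
  "Samples \<equiv> \<Pi>\<^sub>M _\<in>I \<times> (UNIV :: 'k set). U"

lemma iid_product_samples: "iid_product U (I \<times> (UNIV :: 'k::finite set))"
  by (simp add: iid_product.intro prob_space_U finite_I)

lemma measurable_pick [measurable]: "pick n \<in> measurable Samples P"
  unfolding pick_def by (rule measurable_restrict) (auto intro: measurable_component_singleton)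

lemma distr_pick: "distr (Samples :: ('i \<times> 'k::finite \<Rightarrow> 'a) measure) P (pick n) = P"
proof -
  have "pick n = (\<lambda>\<omega>. \<lambda>t\<in>I. \<omega> (t, n t))" by (simp add: pick_def fun_eq_iff)
  then show ?thesis
    using distr_PiM_reindex[of "I \<times> (UNIV :: 'k set)" "\<lambda>_. U" "\<lambda>t. (t, n t)" I]
    by (auto simp: prob_space_U inj_on_def)
qed

lemma pick_cong: "(\<And>t. t \<in> I \<Longrightarrow> n t = n' t) \<Longrightarrow> pick n = pick n'"
  unfolding pick_def by (intro ext restrict_ext) simp

lemma AE_pick:
  fixes n :: "'i \<Rightarrow> 'k::finite"
  assumes "AE x in P. R x"
  shows "AE \<omega> in Samples. R (pick n \<omega>)"
proof -
  have "AE x in distr (Samples :: ('i \<times> 'k \<Rightarrow> 'a) measure) P (pick n). R x"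
    using assms by (simp only: distr_pick)
  then show ?thesis by (rule AE_distrD[OF measurable_pick])
qed

lemma AE_pickD:
  fixes n :: "'i \<Rightarrow> 'k::finite"
  assumes "AE \<omega> in Samples. R (pick n \<omega>)" "{x \<in> space P. R x} \<in> sets P"
  shows "AE x in P. R x"
proof -
  have "AE x in distr (Samples :: ('i \<times> 'k \<Rightarrow> 'a) measure) P (pick n). R x"
    using assms by (simp add: AE_distr_iff[OF measurable_pick])
  then show ?thesis by (simp only: distr_pick)
qed

text \<open>Makes events about disjoint groups of samples independent.\<close>

lemma depends_on_pick:
  fixes n n' :: "'i \<Rightarrow> 'k::finite"
  assumes "\<And>t. t \<in> I \<Longrightarrow> n t \<in> N" "\<And>t. t \<in> I \<Longrightarrow> n' t \<in> N"
  shows "iid_product.depends_on U (I \<times> UNIV)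
    {\<omega> \<in> space Samples. R (pick n \<omega>) (pick n' \<omega>)} (I \<times> N)"
proof -
  interpret S: iid_product U "I \<times> (UNIV :: 'k set)" by (rule iid_product_samples)
  show ?thesis
    unfolding S.depends_on_def
  proof (intro ballI impI)
    fix \<omega> \<omega>' :: "'i \<times> 'k \<Rightarrow> 'a"
    assume "\<forall>q\<in>I \<times> UNIV \<inter> I \<times> N. \<omega> q = \<omega>' q"
    then have "pick n \<omega> = pick n \<omega>'" "pick n' \<omega> = pick n' \<omega>'"
      using assms by (auto simp: pick_def fun_eq_iff)
    moreover assume "\<omega>' \<in> space Samples" "\<omega> \<in> {\<omega> \<in> space Samples. R (pick n \<omega>) (pick n' \<omega>)}"
    ultimately show "\<omega>' \<in> {\<omega> \<in> space Samples. R (pick n \<omega>) (pick n' \<omega>)}" by simp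
  qed
qed

text \<open>Sample \<open>u\<close> gives a point \<open>x\<close>, and sample \<open>v\<close>
  fresh values outside \<open>J\<close>. If the event were null, then for almost every
  \<open>x\<close> outside \<open>A\<close> almost all resampled points would miss \<open>A\<close>,
  so \<open>x\<close> would be outside \<open>ess J A\<close>.\<close>

lemma undetermined_sample_pos:
  fixes u v :: "'k::finite"
  assumes A: "A \<in> sets P" and nd: "\<not> determined J A" and uv: "u \<noteq> v"
  shows "0 < measure Samples
    {\<omega> \<in> space Samples. pick (\<lambda>_. u) \<omega> \<notin> A \<and> pick (\<lambda>t. if t \<in> J then u else v) \<omega> \<in> A}"
    (is "0 < measure _ ?E")
proof (rule ccontr)
  interpret S: iid_product U "I \<times> (UNIV :: 'k set)" by (rule iid_product_samples)
  assume "\<not> 0 < measure Samples ?E"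
  then have "measure Samples ?E = 0" by (simp add: zero_less_measure_iff)
  moreover have "?E \<in> sets Samples" using A by measurable
  ultimately have "AE \<omega> in Samples. \<omega> \<notin> ?E" using S.AE_not_in_iff_measure by blast
  \<comment> \<open>Sample \<open>u\<close> is kept and all others are resampled.\<close>
  from S.AE_mix[OF this, of "I \<times> {u}"]
  have "AE \<omega> in Samples. pick (\<lambda>_. u) \<omega> \<in> ess J A \<longrightarrow> pick (\<lambda>_. u) \<omega> \<in> A"
    using AE_space
  proof eventually_elim
    case (elim \<omega>)
    let ?x = "pick (\<lambda>_. u) \<omega>"
    have x: "?x \<in> space P" using measurable_space[OF measurable_pick] elim by blast
    have "AE \<omega>' in Samples. ?x \<notin> A \<longrightarrow> mix J ?x (pick (\<lambda>_. v) \<omega>') \<notin> A"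
      using elim(1) AE_space
    proof eventually_elim
      case (elim \<omega>')
      let ?m = "S.mix (I \<times> {u}) \<omega> \<omega>'"
      have "pick (\<lambda>_. u) ?m = ?x" by (auto simp: pick_def fun_eq_iff)
      moreover have "pick (\<lambda>t. if t \<in> J then u else v) ?m = mix J ?x (pick (\<lambda>_. v) \<omega>')"
        using uv by (auto simp: pick_def mix_def fun_eq_iff)
      moreover have "?m \<in> space Samples" using elim \<open>\<omega> \<in> space Samples\<close> by simp
      ultimately show ?case using elim by auto
    qed
    then have "AE y in P. ?x \<notin> A \<longrightarrow> mix J ?x y \<notin> A"
      using A x by (rule_tac AE_pickD[where n = "\<lambda>_. v"]) auto
    then show ?case using not_in_ess_iff[OF A x, of J] by (cases "?x \<in> A") auto
  qed
  then have "determined J A"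
    unfolding determined_def using A by (intro AE_pickD[where n = "\<lambda>_. u"]) auto
  with nd show False by simp
qed

end

section \<open>Partitions into five events of probability one fifth\<close>

text \<open>The arithmetic-geometric mean inequality for the crossed products gives
  \<open>2/5 \<le> d * (1 - b) + e * (1 - a)\<close>. Adding the two hypotheses gives
  \<open>4/5 \<le> 2 - a - b\<close>, so \<open>a * b\<close> is at most 9/25.\<close>

lemma rectangle_area_contradiction:
  fixes a b d e :: real
  assumes "0 \<le> d" "0 \<le> e" "d + e \<le> 1" "1/5 \<le> d * (1 - a)" "1/5 \<le> e * (1 - b)" "2/5 \<le> a * b"
    and "a \<le> 1" "b \<le> 1" "0 \<le> a" "0 \<le> b"
  shows False
proof -
  have "(1/5) * (1/5) \<le> (d * (1 - a)) * (e * (1 - b))"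
    using assms by (intro mult_mono) auto
  then have "4 * (1/25) \<le> 4 * ((d * (1 - b)) * (e * (1 - a)))" by (simp add: algebra_simps)
  also have "\<dots> \<le> (d * (1 - b) + e * (1 - a))\<^sup>2"
    using sum_squares_bound[of "d * (1 - b)" "e * (1 - a)"] unfolding power2_sum by linarith
  finally have "(2/5)\<^sup>2 \<le> (d * (1 - b) + e * (1 - a))\<^sup>2" by (simp add: power2_eq_square)
  then have *: "2/5 \<le> d * (1 - b) + e * (1 - a)"
    using assms by (rule_tac power2_le_imp_le) auto
  have "(d + e) * ((1 - a) + (1 - b)) \<le> 1 * ((1 - a) + (1 - b))"
    using assms by (intro mult_right_mono) auto
  with * have "a + b \<le> 6/5" using assms by (simp add: algebra_simps)
  then have "(a + b)\<^sup>2 \<le> (6/5)\<^sup>2" using assms by (intro power_mono) auto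
  moreover have "4 * (a * b) \<le> (a + b)\<^sup>2"
    using sum_squares_bound[of a b] by (simp add: power2_sum)
  ultimately show False using assms by (simp add: power2_eq_square)
qed

text \<open>In increasing order the \<open>q t\<close> are at most 1/3, 1/2 and 1, which bounds the
  corresponding \<open>f t\<close> by 2/5, 3/5 and 4/5, with product 24/125.\<close>

lemma product_less_fifth:
  fixes q f :: "nat \<Rightarrow> real"
  assumes q: "q 0 + q 1 + q 2 \<le> 1" "\<And>t. 0 \<le> q t"
    and f: "\<And>t. 0 \<le> f t" "\<And>t. f t \<le> 1" and fq: "\<And>t. t < 3 \<Longrightarrow> 1/5 \<le> (1 - f t) * q t"
  shows "f 0 * f 1 * f 2 < 1/5"
proof -
  have bound: "f t \<le> 1 - 1 / (5 * c)" if "t < 3" "q t \<le> c" "0 < c" for t c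
  proof -
    have "1/5 \<le> (1 - f t) * c"
      using fq[OF that(1)] mult_left_mono[OF that(2), of "1 - f t"] f(2)[of t] by linarith
    then show ?thesis using that by (simp add: field_simps)
  qed
  have *: "f r * f s * f t < 1/5"
    if "r < 3" "s < 3" "t < 3" "q r + q s + q t \<le> 1" "q r \<le> q s" "q s \<le> q t" for r s t
  proof -
    have "f r \<le> 2/5" using bound[of r "1/3"] that q(2) by auto
    moreover have "f s \<le> 3/5" using bound[of s "1/2"] that q(2)[of r] by auto
    moreover have "f t \<le> 4/5" using bound[of t 1] that q(2)[of r] q(2)[of s] by auto
    ultimately have "f r * f s * f t \<le> 2/5 * (3/5) * (4/5)"
      using f by (intro mult_mono) auto
    then show ?thesis by simp
  qed
  consider "q 0 \<le> q 1" "q 1 \<le> q 2" | "q 0 \<le> q 2" "q 2 \<le> q 1" | "q 1 \<le> q 0" "q 0 \<le> q 2"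
    | "q 1 \<le> q 2" "q 2 \<le> q 0" | "q 2 \<le> q 0" "q 0 \<le> q 1" | "q 2 \<le> q 1" "q 1 \<le> q 0"
    by linarith
  then show ?thesis
    using *[of 0 1 2] *[of 0 2 1] *[of 1 0 2] *[of 1 2 0] *[of 2 0 1] *[of 2 1 0] q(1)
    by cases (simp_all add: mult_ac add_ac)
qed

text \<open>The coordinates \<open>i\<close>, \<open>j\<close>, \<open>k\<close> are private to
  \<open>A\<close>, \<open>B\<close>, \<open>C\<close> among these three events, and
  \<open>l\<close>, \<open>m\<close> are common to them. Coordinates and events are parameters so
  that symmetries become further instances.\<close>

locale fifths = iid_product U I for U :: "'a measure" and I :: "'i set" +
  fixes i j k l m :: 'i and A B C D E :: "('i \<Rightarrow> 'a) set"
  assumes distinct: "distinct [i, j, k, l, m]" and I: "I = {i, j, k, l, m}"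
    and sets [measurable]: "A \<in> sets P" "B \<in> sets P" "C \<in> sets P" "D \<in> sets P" "E \<in> sets P"
    and depends: "depends_on A {i, l, m}" "depends_on B {j, l, m}" "depends_on C {k, l, m}"
      "depends_on D {i, j, k, l}" "depends_on E {i, j, k, m}"
    and prob: "measure P A = 1/5" "measure P B = 1/5" "measure P C = 1/5" "measure P D = 1/5"
      "measure P E = 1/5"
    and cover: "AE x in P. x \<in> A \<or> x \<in> B \<or> x \<in> C \<or> x \<in> D \<or> x \<in> E"
    and disjoint: "AE x in P. \<not> (x \<in> A \<and> x \<in> B)" "AE x in P. \<not> (x \<in> A \<and> x \<in> C)"
      "AE x in P. \<not> (x \<in> B \<and> x \<in> C)" "AE x in P. \<not> (x \<in> A \<and> x \<in> D)"
      "AE x in P. \<not> (x \<in> B \<and> x \<in> D)" "AE x in P. \<not> (x \<in> C \<and> x \<in> D)"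
      "AE x in P. \<not> (x \<in> A \<and> x \<in> E)" "AE x in P. \<not> (x \<in> B \<and> x \<in> E)"
      "AE x in P. \<not> (x \<in> C \<and> x \<in> E)" "AE x in P. \<not> (x \<in> D \<and> x \<in> E)"
begin

section \<open>Cases excluded by measure\<close>

lemma prob_ess_of_determined:
  assumes "X \<in> sets P" "determined J X"
  shows "measure P (ess J X) = measure P X"
proof (rule P.finite_measure_eq_AE)
  show "AE x in P. x \<in> ess J X \<longleftrightarrow> x \<in> X"
    using AE_in_ess[OF assms(1), of J] assms(2) unfolding determined_def
    by eventually_elim blast
qed (use assms in auto)

text \<open>\<open>?R\<close> lies over the \<open>(l, m)\<close>-square and has measure at least
  2/5. It shares only \<open>l\<close> with \<open>D\<close> and only \<open>m\<close> with
  \<open>E\<close>, so these pairs have disjoint projections to \<open>l\<close> and to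
  \<open>m\<close>; the projections of \<open>D\<close> and \<open>E\<close> to
  \<open>{i, j, k}\<close> are disjoint too. The sides of the rectangle are the projections of
  \<open>?R\<close>.\<close>

lemma not_both_determined:
  assumes B: "determined {l, m} B" and C: "determined {l, m} C"
  shows False
proof -
  let ?R = "ess {l, m} B \<union> ess {l, m} C"
  have R: "depends_on ?R {l, m}"
    using depends_on_ess[of "{l,m}"] unfolding depends_on_def by blast
  have RX: "AE x in P. \<not> (x \<in> X \<and> x \<in> ?R)"
    if "AE x in P. \<not> (x \<in> B \<and> x \<in> X)" "AE x in P. \<not> (x \<in> C \<and> x \<in> X)" for X
    using B C that unfolding determined_def by eventually_elim auto
  have "measure P B + measure P C = measure P (B \<union> C)"
    using disjoint(3) by (simp add: prob_Un_AE_disjoint)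
  also have "\<dots> \<le> measure P ?R"
    using AE_in_ess[OF sets(2), of "{l,m}"] AE_in_ess[OF sets(3), of "{l,m}"]
    by (intro P.finite_measure_mono_AE) auto
  also have "\<dots> \<le> measure P (ess {l} ?R) * measure P (ess {m} ?R)"
    using distinct by (intro prob_le_ess_mult) auto
  finally have r: "2/5 \<le> measure P (ess {l} ?R) * measure P (ess {m} ?R)" by (simp add: prob)
  have l: "measure P (ess {l} D) + measure P (ess {l} ?R) \<le> 1"
    using distinct
    by (intro prob_add_le_1 sets_ess AE_ess_disjoint[OF _ depends(4) _ R _ RX[OF disjoint(5,6)]]) auto
  have m: "measure P (ess {m} E) + measure P (ess {m} ?R) \<le> 1"
    using distinct
    by (intro prob_add_le_1 sets_ess AE_ess_disjoint[OF _ depends(5) _ R _ RX[OF disjoint(8,9)]]) auto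
  have DE: "measure P (ess {i,j,k} D) + measure P (ess {i,j,k} E) \<le> 1"
    using distinct
    by (intro prob_add_le_1 sets_ess AE_ess_disjoint[OF _ depends(4) _ depends(5) _ disjoint(10)]) auto
  have "measure P D \<le> measure P (ess {i,j,k} D) * measure P (ess {l} D)"
    using distinct by (intro prob_le_ess_mult) auto
  also have "\<dots> \<le> measure P (ess {i,j,k} D) * (1 - measure P (ess {l} ?R))"
    using l by (intro mult_left_mono) auto
  finally have D: "1/5 \<le> measure P (ess {i,j,k} D) * (1 - measure P (ess {l} ?R))" by (simp add: prob)
  have "measure P E \<le> measure P (ess {i,j,k} E) * measure P (ess {m} E)"
    using distinct by (intro prob_le_ess_mult) auto
  also have "\<dots> \<le> measure P (ess {i,j,k} E) * (1 - measure P (ess {m} ?R))"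
    using m by (intro mult_left_mono) auto
  finally have E: "1/5 \<le> measure P (ess {i,j,k} E) * (1 - measure P (ess {m} ?R))" by (simp add: prob)
  show False
    by (rule rectangle_area_contradiction[OF _ _ DE D E r]) auto
qed

text \<open>\<open>?F\<close> shares only one private coordinate with each of \<open>A\<close>,
  \<open>B\<close>, \<open>C\<close>, so its projection \<open>f t\<close> there leaves at most
  \<open>1 - f t\<close> to that event. The projections of \<open>A\<close>, \<open>B\<close>,
  \<open>C\<close> to \<open>{l, m}\<close> are disjoint, hence the \<open>q t\<close> sum to at
  most 1.\<close>

lemma not_determined:
  assumes E: "determined {i, j, k} E"
  shows False
proof -
  let ?F = "ess {i, j, k} E"
  \<comment> \<open>Every index from 2 on stands for \<open>C\<close> and \<open>k\<close>, so the
    facts below hold for all \<open>t\<close>.\<close>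
  define X where "X = (\<lambda>t :: nat. if t = 0 then A else if t = 1 then B else C)"
  define s where "s = (\<lambda>t :: nat. if t = 0 then i else if t = 1 then j else k)"
  define q where "q t = measure P (ess {l, m} (X t))" for t
  define f where "f t = measure P (ess {s t} ?F)" for t
  have X: "X t \<in> sets P" "depends_on (X t) {s t, l, m}" "measure P (X t) = 1/5"
    "AE x in P. \<not> (x \<in> X t \<and> x \<in> E)" "s t \<noteq> l" "s t \<noteq> m" for t
    using sets depends prob disjoint distinct by (auto simp: X_def s_def)
  have XF: "AE x in P. \<not> (x \<in> X t \<and> x \<in> ?F)" for t
    using X(4)[of t] E unfolding determined_def by eventually_elim auto
  have "1/5 \<le> (1 - f t) * q t" for t
  proof -
    have sets': "{s t, l, m} \<inter> {i, j, k} \<subseteq> {s t}"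
      using distinct by (auto simp: s_def)
    have "measure P (ess {s t} (X t)) + f t \<le> 1"
      unfolding f_def
      by (intro prob_add_le_1 sets_ess AE_ess_disjoint[OF _ X(2) _ depends_on_ess sets' XF] X(1) sets)
    moreover have "1/5 \<le> measure P (ess {s t} (X t)) * q t"
      using prob_le_ess_mult[OF X(1), of "{s t}" "{l, m}" t] X(3,5,6)[of t] by (auto simp: q_def)
    moreover have "0 \<le> q t" by (simp add: q_def)
    ultimately show ?thesis
      using mult_right_mono[of "measure P (ess {s t} (X t))" "1 - f t" "q t"] by linarith
  qed
  moreover have "q 0 + q 1 + q 2 \<le> 1"
  proof -
    have "{i, l, m} \<inter> {j, l, m} \<subseteq> {l, m}" "{i, l, m} \<inter> {k, l, m} \<subseteq> {l, m}"
      "{j, l, m} \<inter> {k, l, m} \<subseteq> {l, m}"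
      using distinct by auto
    note d = AE_ess_disjoint[OF sets(1) depends(1) sets(2) depends(2) this(1) disjoint(1)]
      AE_ess_disjoint[OF sets(1) depends(1) sets(3) depends(3) this(2) disjoint(2)]
      AE_ess_disjoint[OF sets(2) depends(2) sets(3) depends(3) this(3) disjoint(3)]
    have "measure P (ess {l, m} A \<union> ess {l, m} B) = q 0 + q 1"
      using d(1) by (simp add: q_def X_def prob_Un_AE_disjoint)
    moreover have "measure P (ess {l, m} A \<union> ess {l, m} B) + measure P (ess {l, m} C) \<le> 1"
      using d by (intro prob_add_le_1) auto
    ultimately show ?thesis by (simp add: q_def X_def)
  qed
  ultimately have "f 0 * f 1 * f 2 < 1/5"
    by (intro product_less_fifth[of q f]) (auto simp: q_def f_def)
  moreover have "measure P ?F \<le> f 0 * f 1 * f 2"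
    using distinct prob_le_ess_mult3[of ?F "{i}" "{j}" "{k}"] by (simp add: f_def s_def)
  moreover have "measure P ?F = 1/5"
    using prob_ess_of_determined[OF sets(5) E] prob by simp
  ultimately show False by simp
qed

text \<open>Nine samples of each coordinate span a finite grid, and almost surely each grid point is
  in exactly one event. With positive probability \<open>A\<close> and \<open>B\<close> also react
  to their private coordinates, \<open>D\<close> to \<open>l\<close> and \<open>E\<close> to
  \<open>m\<close>, while \<open>C\<close> occurs. Such an outcome contradicts
  \<open>no_mixed_strip_partition\<close>.\<close>

lemma some_determined:
  "determined {l, m} A \<or> determined {l, m} B \<or> determined {i, j, k} D \<or> determined {i, j, k} E"
proof (rule ccontr)
  assume "\<not> ?thesis"
  then have nd: "\<not> determined {l, m} A" "\<not> determined {l, m} B"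
    "\<not> determined {i, j, k} D" "\<not> determined {i, j, k} E" by auto
  define Q :: "('i \<times> 9 \<Rightarrow> 'a) measure" where "Q = Samples"
  interpret S: iid_product U "I \<times> (UNIV :: 9 set)" by (rule iid_product_samples)
  define pt :: "9 \<Rightarrow> 9 \<Rightarrow> 9 \<Rightarrow> 9 \<Rightarrow> 9 \<Rightarrow> 'i \<Rightarrow> 9" where
    "pt a b c y z = (\<lambda>t. if t = i then a else if t = j then b else if t = k then c
      else if t = l then y else z)" for a b c y z
  have pt: "pt a b c y z i = a" "pt a b c y z j = b" "pt a b c y z k = c" "pt a b c y z l = y"
    "pt a b c y z m = z" for a b c y z
    using distinct by (auto simp: pt_def)
  define ev where "ev n n' R = {\<omega> \<in> space Q. R (pick n \<omega>) (pick n' \<omega>)}"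
    for n n' :: "'i \<Rightarrow> 9" and R
  let ?notin = "\<lambda>X x y. x \<notin> X \<and> y \<in> X"
  \<comment> \<open>Separate samples serve the five events: 0 and 1 \<open>A\<close>, 2 and 3
    \<open>B\<close>, 4 \<open>C\<close>, 5 and 6 \<open>D\<close>, 7 and 8 \<open>E\<close>. The
    five requirements are thus independent.\<close>
  define EA where "EA = ev (pt 0 0 0 0 0) (pt 1 1 1 0 0) (?notin A)"
  define EB where "EB = ev (pt 2 2 2 2 2) (pt 3 3 3 2 2) (?notin B)"
  define EC where "EC = ev (pt 4 4 4 4 4) (pt 4 4 4 4 4) (\<lambda>x _. x \<in> C)"
  define ED where "ED = ev (pt 5 5 5 5 5) (pt 5 5 5 6 6) (?notin D)"
  define EE where "EE = ev (pt 7 7 7 7 7) (pt 7 7 7 8 8) (?notin E)"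
  note evs = EA_def EB_def EC_def ED_def EE_def
  have sets_ev: "EA \<in> sets Q" "EB \<in> sets Q" "EC \<in> sets Q" "ED \<in> sets Q" "EE \<in> sets Q"
    unfolding evs ev_def Q_def by measurable
  have dep: "S.depends_on EA (I \<times> {0, 1})" "S.depends_on EB (I \<times> {2, 3})" "S.depends_on EC (I \<times> {4})"
    "S.depends_on ED (I \<times> {5, 6})" "S.depends_on EE (I \<times> {7, 8})"
    unfolding evs ev_def Q_def by (rule depends_on_pick; force simp: I pt)+
  have pos: "0 < measure Q (ev n n' (?notin X))"
    if "X \<in> sets P" "\<not> determined J X" "u \<noteq> v" "\<And>t. t \<in> I \<Longrightarrow> n t = u"
      "\<And>t. t \<in> I \<Longrightarrow> n' t = (if t \<in> J then u else v)" for X J u v n n'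
  proof -
    have "pick n = pick (\<lambda>_. u)" "pick n' = pick (\<lambda>t. if t \<in> J then u else v)"
      using that by (auto intro!: pick_cong)
    then show ?thesis
      using undetermined_sample_pos[OF that(1,2,3)] by (simp add: ev_def Q_def)
  qed
  have "0 < measure Q EA"
    unfolding evs by (rule pos[OF sets(1) nd(1), of 0 1]) (use distinct in \<open>auto simp: I pt\<close>)
  moreover have "0 < measure Q EB"
    unfolding evs by (rule pos[OF sets(2) nd(2), of 2 3]) (use distinct in \<open>auto simp: I pt\<close>)
  moreover have "0 < measure Q ED"
    unfolding evs by (rule pos[OF sets(4) nd(3), of 5 6]) (use distinct in \<open>auto simp: I pt\<close>)
  moreover have "0 < measure Q EE"
    unfolding evs by (rule pos[OF sets(5) nd(4), of 7 8]) (use distinct in \<open>auto simp: I pt\<close>)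
  moreover have "0 < measure Q EC"
  proof -
    have "measure (distr Q P (pick (pt 4 4 4 4 4))) C = measure Q EC"
      unfolding evs ev_def Q_def by (subst measure_distr) (auto intro!: arg_cong[where f = "measure _"])
    then show ?thesis unfolding Q_def distr_pick prob by simp
  qed
  ultimately have "0 < measure Q EA * (measure Q EB * (measure Q EC * (measure Q ED * measure Q EE)))"
    by simp
  also have "\<dots> = measure Q (EA \<inter> (EB \<inter> (EC \<inter> (ED \<inter> EE))))"
  proof -
    have "measure Q (ED \<inter> EE) = measure Q ED * measure Q EE"
      by (rule S.prob_Int_independent[folded Q_def, OF sets_ev(4) dep(4) sets_ev(5) dep(5)]) auto
    moreover note de = sets.Int[OF sets_ev(4,5)] S.depends_on_Int[OF dep(4,5)]
    have "measure Q (EC \<inter> (ED \<inter> EE)) = measure Q EC * measure Q (ED \<inter> EE)"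
      by (rule S.prob_Int_independent[folded Q_def, OF sets_ev(3) dep(3) de]) auto
    moreover note cde = sets.Int[OF sets_ev(3) de(1)] S.depends_on_Int[OF dep(3) de(2)]
    have "measure Q (EB \<inter> (EC \<inter> (ED \<inter> EE))) = measure Q EB * measure Q (EC \<inter> (ED \<inter> EE))"
      by (rule S.prob_Int_independent[folded Q_def, OF sets_ev(2) dep(2) cde]) auto
    moreover note bcde = sets.Int[OF sets_ev(2) cde(1)] S.depends_on_Int[OF dep(2) cde(2)]
    have "measure Q (EA \<inter> (EB \<inter> (EC \<inter> (ED \<inter> EE)))) =
        measure Q EA * measure Q (EB \<inter> (EC \<inter> (ED \<inter> EE)))"
      by (rule S.prob_Int_independent[folded Q_def, OF sets_ev(1) dep(1) bcde]) auto
    ultimately show ?thesis by simp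
  qed
  finally have pos: "measure Q (EA \<inter> (EB \<inter> (EC \<inter> (ED \<inter> EE)))) \<noteq> 0" by simp
  define partition where "partition x \<longleftrightarrow>
      (x \<in> A \<or> x \<in> B \<or> x \<in> C \<or> x \<in> D \<or> x \<in> E) \<and>
      \<not> (x \<in> A \<and> x \<in> B) \<and> \<not> (x \<in> A \<and> x \<in> C) \<and> \<not> (x \<in> B \<and> x \<in> C) \<and>
      \<not> (x \<in> A \<and> x \<in> D) \<and> \<not> (x \<in> B \<and> x \<in> D) \<and> \<not> (x \<in> C \<and> x \<in> D) \<and>
      \<not> (x \<in> A \<and> x \<in> E) \<and> \<not> (x \<in> B \<and> x \<in> E) \<and> \<not> (x \<in> C \<and> x \<in> E) \<and>
      \<not> (x \<in> D \<and> x \<in> E)" for x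
  have "AE x in P. partition x"
    unfolding partition_def using cover disjoint by eventually_elim blast
  then have "AE \<omega> in Q. \<forall>s\<in>UNIV. case s of (a, b, c, y, z) \<Rightarrow> partition (pick (pt a b c y z) \<omega>)"
    unfolding Q_def by (intro AE_finite_allI) (auto simp: split_beta finite_prod intro!: AE_pick)
  then have ae: "AE \<omega> in Q. \<forall>a b c y z. partition (pick (pt a b c y z) \<omega>)" by simp
  have "\<exists>\<omega> \<in> EA \<inter> (EB \<inter> (EC \<inter> (ED \<inter> EE))). \<forall>a b c y z. partition (pick (pt a b c y z) \<omega>)"
  proof (rule ccontr)
    assume "\<not> ?thesis"
    then have "AE \<omega> in Q. \<omega> \<notin> EA \<inter> (EB \<inter> (EC \<inter> (ED \<inter> EE)))"
      using ae by (rule_tac eventually_mono) blast+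
    then show False
      using pos sets_ev S.AE_not_in_iff_measure[folded Q_def, of "EA \<inter> (EB \<inter> (EC \<inter> (ED \<inter> EE)))"] by simp
  qed
  then obtain \<omega> where \<omega>: "\<omega> \<in> EA" "\<omega> \<in> EB" "\<omega> \<in> EC" "\<omega> \<in> ED" "\<omega> \<in> EE"
    and part: "\<And>a b c y z. partition (pick (pt a b c y z) \<omega>)" by blast
  have space: "pick n \<omega> \<in> space P" for n :: "'i \<Rightarrow> 9"
    using measurable_space[OF measurable_pick] \<omega>(1) unfolding EA_def ev_def Q_def by blast
  have mem: "pick n \<omega> \<in> X \<longleftrightarrow> pick n' \<omega> \<in> X"
    if "depends_on X J" "\<And>t. t \<in> I \<Longrightarrow> t \<in> J \<Longrightarrow> n t = n' t" for X J and n n' :: "'i \<Rightarrow> 9"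
    by (rule depends_onD[OF that(1) space space]) (simp add: pick_def that(2))
  \<comment> \<open>The zeros are arbitrary values of coordinates on which the event does not
    depend.\<close>
  define f where "f a y z \<longleftrightarrow> pick (pt a 0 0 y z) \<omega> \<in> A" for a y z
  define g where "g b y z \<longleftrightarrow> pick (pt 0 b 0 y z) \<omega> \<in> B" for b y z
  define h where "h c y z \<longleftrightarrow> pick (pt 0 0 c y z) \<omega> \<in> C" for c y z
  define p where "p a b c y \<longleftrightarrow> pick (pt a b c y 0) \<omega> \<in> D" for a b c y
  define q where "q a b c z \<longleftrightarrow> pick (pt a b c 0 z) \<omega> \<in> E" for a b c z
  have valA: "pick (pt a b c y z) \<omega> \<in> A \<longleftrightarrow> f a y z" for a b c y z
    unfolding f_def by (rule mem[OF depends(1)]) (auto simp: pt)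
  have valB: "pick (pt a b c y z) \<omega> \<in> B \<longleftrightarrow> g b y z" for a b c y z
    unfolding g_def by (rule mem[OF depends(2)]) (auto simp: pt)
  have valC: "pick (pt a b c y z) \<omega> \<in> C \<longleftrightarrow> h c y z" for a b c y z
    unfolding h_def by (rule mem[OF depends(3)]) (auto simp: pt)
  have valD: "pick (pt a b c y z) \<omega> \<in> D \<longleftrightarrow> p a b c y" for a b c y z
    unfolding p_def by (rule mem[OF depends(4)]) (auto simp: pt)
  have valE: "pick (pt a b c y z) \<omega> \<in> E \<longleftrightarrow> q a b c z" for a b c y z
    unfolding q_def by (rule mem[OF depends(5)]) (auto simp: pt)
  note val = valA valB valC valD valE
  show False
  proof (rule no_mixed_strip_partition[of f g h p q])
    show "\<not> (f a y z \<and> g b y z)" for a b y z using part[of a b 0 y z, unfolded partition_def val] by blast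
    show "\<not> (f a y z \<and> h c y z)" for a c y z using part[of a 0 c y z, unfolded partition_def val] by blast
    show "\<not> (g b y z \<and> h c y z)" for b c y z using part[of 0 b c y z, unfolded partition_def val] by blast
    show "\<not> (p a b c y \<and> q a b c z)" for a b c y z using part[of a b c y z, unfolded partition_def val] by blast
    show "(p a b c y \<or> q a b c z) = (\<not> f a y z \<and> \<not> g b y z \<and> \<not> h c y z)" for a b c y z
      using part[of a b c y z, unfolded partition_def val] by blast
    show "f 0 0 0 \<noteq> f 1 0 0" "g 2 2 2 \<noteq> g 3 2 2" "h 4 4 4" "p 5 5 5 6" "\<not> p 5 5 5 5" "q 7 7 7 8" "\<not> q 7 7 7 7"
      using \<omega> by (simp_all add: evs ev_def val)
  qed
qed

section \<open>Symmetries of the five events\<close>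

lemma disjoint_sym: "AE x in P. \<not> (x \<in> X \<and> x \<in> Y) \<Longrightarrow> AE x in P. \<not> (x \<in> Y \<and> x \<in> X)"
  by (simp add: conj_commute)

lemma swap_ij: "fifths U I j i k l m B A C D E"
proof unfold_locales
  show "distinct [j, i, k, l, m]" using distinct by auto
  show "I = {j, i, k, l, m}" using I by (simp add: insert_commute)
  show "depends_on B {j, l, m}" "depends_on A {i, l, m}" "depends_on C {k, l, m}"
    "depends_on D {j, i, k, l}" "depends_on E {j, i, k, m}"
    using depends by (simp_all add: insert_commute)
  show "AE x in P. x \<in> B \<or> x \<in> A \<or> x \<in> C \<or> x \<in> D \<or> x \<in> E"
    using cover by eventually_elim blast
qed (rule sets prob disjoint disjoint[THEN disjoint_sym])+

lemma swap_jk: "fifths U I i k j l m A C B D E"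
proof unfold_locales
  show "distinct [i, k, j, l, m]" using distinct by auto
  show "I = {i, k, j, l, m}" using I by (simp add: insert_commute)
  show "depends_on A {i, l, m}" "depends_on C {k, l, m}" "depends_on B {j, l, m}"
    "depends_on D {i, k, j, l}" "depends_on E {i, k, j, m}"
    using depends by (simp_all add: insert_commute)
  show "AE x in P. x \<in> A \<or> x \<in> C \<or> x \<in> B \<or> x \<in> D \<or> x \<in> E"
    using cover by eventually_elim blast
qed (rule sets prob disjoint disjoint[THEN disjoint_sym])+

lemma swap_lm: "fifths U I i j k m l A B C E D"
proof unfold_locales
  show "distinct [i, j, k, m, l]" using distinct by auto
  show "I = {i, j, k, m, l}" using I by (simp add: insert_commute)
  show "depends_on A {i, m, l}" "depends_on B {j, m, l}" "depends_on C {k, m, l}"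
    "depends_on E {i, j, k, m}" "depends_on D {i, j, k, l}"
    using depends by (simp_all add: insert_commute)
  show "AE x in P. x \<in> A \<or> x \<in> B \<or> x \<in> C \<or> x \<in> E \<or> x \<in> D"
    using cover by eventually_elim blast
qed (rule sets prob disjoint disjoint[THEN disjoint_sym])+

lemma two_determined: "determined {l, m} A \<or> determined {l, m} B"
  using some_determined not_determined fifths.not_determined[OF swap_lm] by blast

end

text \<open>Every pair among \<open>A\<close>, \<open>B\<close>, \<open>C\<close> contains an event
  determined by \<open>{l, m}\<close>, so two of the three are.\<close>

lemma (in fifths) contradiction: False
proof -
  interpret swap_jk: fifths U I i k j l m A C B D E by (rule swap_jk)
  interpret swap_ij: fifths U I j i k l m B A C D E by (rule swap_ij)
  interpret rotate: fifths U I j k i l m B C A D E by (rule swap_ij.swap_jk)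
  interpret rotate': fifths U I k i j l m C A B D E by (rule swap_jk.swap_ij)
  show False
    using two_determined swap_jk.two_determined rotate.two_determined
      not_both_determined swap_ij.not_both_determined rotate'.not_both_determined
    by blast
qed

section \<open>The cube\<close>

text \<open>The union has probability 1, but at most the sum minus the probability of
  \<open>A s \<inter> A t\<close>; with the sum at most 1 no overlap is left.\<close>

lemma (in prob_space) AE_disjoint_if_cover:
  assumes T: "finite T" and A: "\<And>t. t \<in> T \<Longrightarrow> A t \<in> events"
    and cover: "AE x in M. \<exists>t\<in>T. x \<in> A t" and sum: "(\<Sum>t\<in>T. prob (A t)) \<le> 1"
    and st: "s \<in> T" "t \<in> T" "s \<noteq> t"
  shows "AE x in M. \<not> (x \<in> A s \<and> x \<in> A t)"
proof -
  let ?R = "T - {s, t}"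
  have "1 = prob (\<Union>t\<in>T. A t)"
    using T A cover by (intro prob_eq_1[THEN iffD2, symmetric]) auto
  also have "(\<Union>t\<in>T. A t) = (A s \<union> A t) \<union> (\<Union>t\<in>?R. A t)" using st by auto
  also have "prob \<dots> \<le> prob (A s \<union> A t) + prob (\<Union>t\<in>?R. A t)"
    using A st T by (intro measure_Un_le) auto
  also have "prob (\<Union>t\<in>?R. A t) \<le> (\<Sum>t\<in>?R. prob (A t))"
    using A T by (intro measure_UNION_le) auto
  also have "(\<Sum>t\<in>?R. prob (A t)) = (\<Sum>t\<in>T. prob (A t)) - prob (A s) - prob (A t)"
    using T st by (simp add: sum.remove[of T s] sum.remove[of "T - {s}" t] Diff_insert2[symmetric])
  finally have "prob (A s) + prob (A t) \<le> prob (A s \<union> A t)" using sum by simp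
  moreover have "prob (A s \<union> A t) = prob (A s) + prob (A t) - prob (A s \<inter> A t)"
    using A st by (simp add: finite_measure_Union' finite_measure_Diff' Int_commute)
  ultimately have "prob (A s \<inter> A t) = 0" using measure_nonneg[of M "A s \<inter> A t"] by linarith
  then have "A s \<inter> A t \<in> null_sets M"
    using A st by (simp add: null_sets_def emeasure_eq_measure)
  then show ?thesis using AE_not_in by fastforce
qed

abbreviation unit_interval :: "real measure" where
  "unit_interval \<equiv> restrict_space lborel {0..1}"

lemma prob_space_unit_interval: "prob_space unit_interval"
  by (rule prob_spaceI) (simp add: emeasure_restrict_space space_restrict_space)

text \<open>\<open>B\<close> is replaced by its main part, which is measurable without completion.
  The null difference stays null under preimage, since restriction to \<open>J\<close> carries the
  product measure over \<open>I\<close> to the one over \<open>J\<close>.\<close>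

lemma cylinder_AE_eq_measurable:
  assumes J: "J \<subseteq> I" and I: "finite I" and B: "B \<in> sets (cube J)"
  obtains A where "A \<in> sets (\<Pi>\<^sub>M j\<in>I. unit_interval)"
    "iid_product.depends_on unit_interval I A J"
    "AE x in \<Pi>\<^sub>M j\<in>I. unit_interval. restrict x J \<in> B \<longleftrightarrow> x \<in> A"
proof -
  let ?U = unit_interval
  let ?PI = "\<Pi>\<^sub>M j\<in>I. ?U" and ?PJ = "\<Pi>\<^sub>M j\<in>J. ?U"
  interpret iid_product ?U I using I by (simp add: iid_product.intro prob_space_unit_interval)
  have B': "B \<in> sets (completion ?PJ)" using B by (simp add: cube_def)
  let ?B = "main_part ?PJ B"
  let ?A = "{x \<in> space ?PI. restrict x J \<in> ?B}"
  have meas: "(\<lambda>x. restrict x J) \<in> measurable ?PI ?PJ"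
    using J by (rule measurable_restrict_subset)
  have "distr ?PI ?PJ (\<lambda>x. restrict x J) = ?PJ"
    using distr_PiM_reindex[of I "\<lambda>_. ?U" "\<lambda>t. t" J] J
    by (auto simp: prob_space_unit_interval restrict_def)
  moreover have "AE y in ?PJ. y \<in> ?B \<longleftrightarrow> y \<in> B"
    by (rule AE_in_main_part[OF B'])
  ultimately have "AE y in distr ?PI ?PJ (\<lambda>x. restrict x J). y \<in> ?B \<longleftrightarrow> y \<in> B"
    by (simp only:)
  from AE_distrD[OF meas this] AE_space
  have "AE x in ?PI. restrict x J \<in> B \<longleftrightarrow> x \<in> ?A" by eventually_elim auto
  moreover have "?A \<in> sets ?PI"
    using measurable_sets[OF meas main_part_sets[OF B']] by (simp add: vimage_def Int_def conj_commute)
  moreover have "depends_on ?A J"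
    unfolding depends_on_def
  proof (intro ballI impI)
    fix x y assume "\<forall>i\<in>I \<inter> J. x i = y i" "x \<in> ?A" "y \<in> space ?PI"
    moreover from this have "restrict x J = restrict y J" using J by (auto simp: restrict_def fun_eq_iff)
    ultimately show "y \<in> ?A" by simp
  qed
  ultimately show thesis using that by blast
qed

lemma lnbh_H_star:
  "lnbh H_star 1 = {1, 4, 5}" "lnbh H_star 2 = {2, 4, 5}" "lnbh H_star 3 = {3, 4, 5}"
  "lnbh H_star 4 = {1, 2, 3, 4}" "lnbh H_star 5 = {1, 2, 3, 5}"
  by (auto simp: lnbh_def H_star_def)

lemma fifth_in_var_interior: "(\<lambda>_. 1/5) \<in> var_interior H_star"
proof -
  let ?U = unit_interval
  define I where "I = {1..5::nat}"
  let ?P = "\<Pi>\<^sub>M j\<in>I. ?U"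
  have fin: "finite I" and I5: "I = {1, 2, 3, 4, 5}" by (auto simp: I_def)
  interpret iid_product ?U I using fin by (simp add: iid_product.intro prob_space_unit_interval)
  interpret C: prob_space "completion ?P" by (rule P.prob_space_completion)
  have sz: "{1..lsize H_star} = I" "{1..rsize H_star} = I" by (simp_all add: H_star_def I_def)
  have nb_sub: "lnbh H_star i \<subseteq> I" for i by (auto simp: lnbh_def H_star_def I_def)
  have pos: "measure (cube I) (space (cube I) \<inter> (\<Inter>i\<in>I. space (cube I) - A i)) > 0"
    if conf: "conforms H_star A" and pr: "\<forall>i\<in>I. measure (cube I) (A i) = 1/5" for A
  proof (rule ccontr)
    let ?N = "space ?P \<inter> (\<Inter>i\<in>I. space ?P - A i)"
    have A: "A i \<in> sets (completion ?P)" if "i \<in> I" for i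
      using conf that unfolding conforms_def sz cube_def by blast
    have "\<exists>X. X \<in> sets ?P \<and> depends_on X (lnbh H_star i) \<and> (AE x in ?P. x \<in> A i \<longleftrightarrow> x \<in> X)"
      if i: "i \<in> I" for i
    proof -
      obtain B where B: "B \<in> sets (cube (lnbh H_star i))"
        "A i = {x \<in> space (cube I). restrict x (lnbh H_star i) \<in> B}"
        using conf i unfolding conforms_def sz by blast
      obtain X where X: "X \<in> sets ?P" "depends_on X (lnbh H_star i)"
        "AE x in ?P. restrict x (lnbh H_star i) \<in> B \<longleftrightarrow> x \<in> X"
        using cylinder_AE_eq_measurable[OF nb_sub fin B(1)] by blast
      from X(3) AE_space have "AE x in ?P. x \<in> A i \<longleftrightarrow> x \<in> X"
        by eventually_elim (simp add: B(2) cube_def)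
      with X show ?thesis by blast
    qed
    then have "\<forall>i\<in>I. \<exists>X. X \<in> sets ?P \<and> depends_on X (lnbh H_star i) \<and>
        (AE x in ?P. x \<in> A i \<longleftrightarrow> x \<in> X)" by blast
    from bchoice[OF this] obtain A' where A': "\<forall>i\<in>I. A' i \<in> sets ?P \<and>
        depends_on (A' i) (lnbh H_star i) \<and> (AE x in ?P. x \<in> A i \<longleftrightarrow> x \<in> A' i)" by blast
    have sets: "A' i \<in> sets ?P" if "i \<in> I" for i using A' that by blast
    have prob: "measure ?P (A' i) = 1/5" if i: "i \<in> I" for i
    proof -
      have "AE x in completion ?P. x \<in> A i \<longleftrightarrow> x \<in> A' i" using A' i by (intro AE_completion) blast
      then have "measure (completion ?P) (A i) = measure (completion ?P) (A' i)"
        using A[OF i] sets[OF i] by (intro C.finite_measure_eq_AE) auto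
      moreover have "measure (completion ?P) (A i) = 1/5" using pr i unfolding cube_def by blast
      ultimately show ?thesis using sets[OF i] by simp
    qed
    assume "\<not> ?thesis"
    then have "measure (completion ?P) ?N = 0"
      unfolding zero_less_measure_iff cube_def space_completion by blast
    moreover have "?N \<in> sets (completion ?P)"
      unfolding space_completion[of ?P, symmetric] using A fin I5
      by (intro sets.Int sets.finite_INT sets.Diff sets.top) blast+
    ultimately have "?N \<in> null_sets (completion ?P)"
      using C.emeasure_eq_measure[of ?N] by (intro null_setsI) simp_all
    from AE_not_in[OF this] have "AE x in ?P. x \<notin> ?N" by (simp only: AE_completion_iff)
    moreover have "AE x in ?P. \<forall>i\<in>I. x \<in> A i \<longleftrightarrow> x \<in> A' i"
      using A' fin by (intro AE_finite_allI) blast+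
    ultimately have cover: "AE x in ?P. \<exists>i\<in>I. x \<in> A' i"
      using AE_space by eventually_elim blast
    have disj: "AE x in ?P. \<not> (x \<in> A' s \<and> x \<in> A' t)" if "s \<in> I" "t \<in> I" "s \<noteq> t" for s t
      by (rule P.AE_disjoint_if_cover[OF fin sets cover _ that]) (simp_all add: prob, simp add: I5)
    have mem: "1 \<in> I" "2 \<in> I" "3 \<in> I" "4 \<in> I" "5 \<in> I" by (simp_all add: I5)
    interpret fifths ?U I 1 2 3 4 5 "A' 1" "A' 2" "A' 3" "A' 4" "A' 5"
    proof unfold_locales
      show "depends_on (A' 1) {1, 4, 5}" "depends_on (A' 2) {2, 4, 5}" "depends_on (A' 3) {3, 4, 5}"
        "depends_on (A' 4) {1, 2, 3, 4}" "depends_on (A' 5) {1, 2, 3, 5}"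
        using A' mem unfolding lnbh_H_star[symmetric] by blast+
      show "AE x in ?P. x \<in> A' 1 \<or> x \<in> A' 2 \<or> x \<in> A' 3 \<or> x \<in> A' 4 \<or> x \<in> A' 5"
        using cover by eventually_elim (auto simp: I5)
      show "I = {1, 2, 3, 4, 5}" by (rule I5)
      show "distinct [1, 2, 3, 4, 5 :: nat]" by simp
    qed (rule mem mem[THEN sets] mem[THEN prob] disj | simp)+
    show False by (rule contradiction)
  qed
  show ?thesis
    unfolding var_interior_def mem_Collect_eq sz using pos by auto
qed

section \<open>Disjoint events on a complete base graph\<close>

lemma fifth_not_in_abs_interior: "(\<lambda>_. 1/5) \<notin> abs_interior 5 (base_edges H_star)"
proof
  assume *: "(\<lambda>_. 1/5) \<in> abs_interior 5 (base_edges H_star)"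
  \<comment> \<open>Sample points must have type \<open>nat set\<close>, so the point
    \<open>n\<close> is encoded as \<open>{n}\<close>.\<close>
  define S where "S = (\<lambda>n :: nat. {n}) ` {1..5}"
  have S: "finite S" "S \<noteq> {}" "card S = 5" by (simp_all add: S_def card_image)
  have in_S: "{i} \<in> S" if "i \<in> {1..5}" for i using that by (simp add: S_def)
  let ?M = "uniform_count_measure S"
  interpret prob_space ?M by (rule prob_space_uniform_count_measure) (use S in auto)
  \<comment> \<open>Vertices 1, 2, 3 share 4 and 5; vertices 4 and 5 share 1, 2, 3; and each
    \<open>i \<le> 3\<close> shares \<open>i\<close> with 4 and with 5.\<close>
  have complete: "{j \<in> {1..5}. j \<noteq> i \<and> j \<notin> nbh (base_edges H_star) i} = {}" if "i \<in> {1..5}" for i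
  proof -
    have "{1..5} = {1, 2, 3, 4, 5 :: nat}" by auto
    then have "\<forall>i\<in>{1..5}. \<forall>j\<in>{1..5}. lnbh H_star i \<inter> lnbh H_star j \<noteq> {}"
      by (simp only:) (simp add: lnbh_H_star del: One_nat_def)
    then have nonempty: "lnbh H_star i \<inter> lnbh H_star j \<noteq> {}" if "j \<in> {1..5}" for j
      using that \<open>i \<in> {1..5}\<close> by blast
    have "lsize H_star = 5" by (simp add: H_star_def)
    then have "{i, j} \<in> base_edges H_star" if "j \<in> {1..5}" "j \<noteq> i" for j
      using that \<open>i \<in> {1..5}\<close> nonempty[OF that(1)] unfolding base_edges_def mem_Collect_eq by metis
    then show ?thesis by (auto simp: nbh_def)
  qed
  have dep: "dependency_graph 5 (base_edges H_star) ?M (\<lambda>i. {{i}})"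
    unfolding dependency_graph_def
  proof
    fix i :: nat assume i: "i \<in> {1..5}"
    have "{{i}} \<in> events" using in_S[OF i] by (simp add: sets_uniform_count_measure)
    then show "indep_set {{{i}}} (sigma_sets (space ?M)
        ((\<lambda>i. {{i}}) ` {j \<in> {1..5}. j \<noteq> i \<and> j \<notin> nbh (base_edges H_star) i}))"
      unfolding complete[OF i] indep_sets2_eq
      by (auto simp: sigma_sets_empty_eq prob_space dest: sets.sets_into_space)
  qed
  have "\<forall>i\<in>{1..5}. {{i}} \<in> events \<and> prob {{i}} = 1/5"
    using S in_S by (simp add: sets_uniform_count_measure measure_uniform_count_measure)
  with * have "prob (space ?M \<inter> (\<Inter>i\<in>{1..5}. space ?M - {{i}})) > 0"
    using prob_space_axioms dep unfolding abs_interior_def mem_Collect_eq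
    by (elim conjE allE[of _ ?M] allE[of _ "\<lambda>i. {{i}}"] impE) (intro conjI; assumption)
  moreover have "space ?M \<inter> (\<Inter>i\<in>{1..5}. space ?M - {{i}}) = {}"
    unfolding space_uniform_count_measure S_def by blast
  ultimately show False by simp
qed

theorem theorem17: "gapful H_star"
proof -
  \<comment> \<open>The factor 1 is the scaling constant in \<open>gapful\<close>.\<close>
  have "(\<lambda>i. 1 * (1/5)) \<in> var_interior H_star - abs_interior (lsize H_star) (base_edges H_star)"
    using fifth_in_var_interior fifth_not_in_abs_interior by (simp add: H_star_def)
  then show ?thesis
    unfolding gapful_def by (intro bexI[of _ "\<lambda>_. 1/5"] exI[of _ 1]) auto
qed

end
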